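(* Let $n,m$ be positive integers. A $\mathrm{QUH}(n,m)$ is equivalent to a pair of $n\times n$ amicable $(\pm1)$-matrices $A$ and $B$ satisfying $AA^T+mBB^T=(m+1)nI_n$. Explicitly: for $n\times n$ $(\pm1)$-matrices $A,B$, the matrix $$H=\frac{1}{\sqrt{m+1}}A+i\sqrt{\frac{m}{m+1}}\,B$$ is a $\mathrm{QUH}(n,m)$ if and only if $A$ and $B$ are amicable and $AA^T+mBB^T=(m+1)nI_n$; and every $\mathrm{QUH}(n,m)$ is of this form for some $n\times n$ $(\pm1)$-matrices $A,B$.
   Context: A unit Hadamard matrix of order $n$ is an $n\times n$ complex matrix $H$ all of whose entries have modulus $1$ and with $HH^*=nI_n$. For positive integers $n,m$, a $\mathrm{QUH}(n,m)$ (quaternary unit Hadamard matrix) is a unit Hadamard matrix of order $n$ all of whose entries lie in the four-element set $\left\{\epsilon\frac{1}{\sqrt{m+1}}+\delta\, i\sqrt{\frac{m}{m+1}} : \epsilon,\delta\in\{1,-1\}\right\}$. Two complex matrices $A,B$ are amicable if $AB^*=BA^*$ (for real matrices, $AB^T=BA^T$). A $(\pm1)$-matrix is a matrix with all entries in $\{1,-1\}$. *)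

theory Defs
  imports "HOL-Analysis.Analysis" "Jordan_Normal_Form.Schur_Decomposition"
begin

definition unit_hadamard :: "nat \<Rightarrow> complex mat \<Rightarrow> bool" where
  "unit_hadamard n H \<longleftrightarrow>
     H \<in> carrier_mat n n \<and>
     (\<forall>i<n. \<forall>j<n. cmod (H $$ (i, j)) = 1) \<and>
     H * mat_adjoint H = of_nat n \<cdot>\<^sub>m 1\<^sub>m n"

definition QUH_entries :: "nat \<Rightarrow> complex set" where
  "QUH_entries m =
     {complex_of_real \<epsilon> * complex_of_real (1 / sqrt (real m + 1))
        + complex_of_real \<delta> * \<i> * complex_of_real (sqrt (real m / (real m + 1)))
      | \<epsilon> \<delta>. \<epsilon> \<in> {1, -1} \<and> \<delta> \<in> {1, -1}}"

definition QUH :: "nat \<Rightarrow> nat \<Rightarrow> complex mat \<Rightarrow> bool" where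
  "QUH n m H \<longleftrightarrow>
     unit_hadamard n H \<and> (\<forall>i<n. \<forall>j<n. H $$ (i, j) \<in> QUH_entries m)"

definition pm1_mat :: "nat \<Rightarrow> real mat \<Rightarrow> bool" where
  "pm1_mat n A \<longleftrightarrow>
     A \<in> carrier_mat n n \<and> (\<forall>i<n. \<forall>j<n. A $$ (i, j) \<in> {1, -1})"

(* Covers complex and real matrices at once: conjugation on real is the identity, so there
   the adjoint is the transpose. *)
definition amicable :: "'a :: conjugatable_field mat \<Rightarrow> 'a mat \<Rightarrow> bool" where
  "amicable A B \<longleftrightarrow> A * mat_adjoint B = B * mat_adjoint A"

lemma mat_adjoint_real: "mat_adjoint (A :: real mat) = transpose_mat A"
  by (rule eq_matI) (auto simp: mat_adjoint_def mat_of_rows_def)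

lemma amicable_real:
  "amicable (A :: real mat) B \<longleftrightarrow> A * transpose_mat B = B * transpose_mat A"
  by (simp add: amicable_def mat_adjoint_real)

definition QUH_of_pair :: "nat \<Rightarrow> real mat \<Rightarrow> real mat \<Rightarrow> complex mat" where
  "QUH_of_pair m A B =
     complex_of_real (1 / sqrt (real m + 1)) \<cdot>\<^sub>m map_mat complex_of_real A
     + (\<i> * complex_of_real (sqrt (real m / (real m + 1)))) \<cdot>\<^sub>m map_mat complex_of_real B"

end

theory Submission
  imports Defs
begin

text \<open>
  Write \<open>c = 1 / sqrt (m + 1)\<close> and \<open>d = sqrt (m / (m + 1))\<close>, so that
  \<open>c\<^sup>2 + d\<^sup>2 = 1\<close> and every entry \<open>\<plusminus>c \<plusminus> \<i>d\<close> has modulus 1.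
  For real \<open>A\<close>, \<open>B\<close> and \<open>H = cA + \<i>dB\<close>, the real part of \<open>H H\<^sup>*\<close> is
  \<open>c\<^sup>2 A A\<^sup>T + d\<^sup>2 B B\<^sup>T\<close> and the imaginary part is
  \<open>cd (B A\<^sup>T - A B\<^sup>T)\<close>, so comparing \<open>H H\<^sup>*\<close> with \<open>n I\<close> amounts to the two conditions on
  \<open>A\<close> and \<open>B\<close>.
\<close>

lemma mult_mat_adjoint_index:
  fixes A B :: "'a :: conjugatable_field mat"
  assumes "A \<in> carrier_mat n p" "B \<in> carrier_mat q p" "i < n" "j < q"
  shows "(A * mat_adjoint B) $$ (i, j) = (\<Sum>k<p. A $$ (i, k) * conjugate (B $$ (j, k)))"
  using assms
  by (auto simp: mat_adjoint_def mat_of_rows_def scalar_prod_def atLeast0LessThan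
        intro!: sum.cong)

lemma mult_transpose_mat_index:
  fixes A B :: "'a :: semiring_0 mat"
  assumes "A \<in> carrier_mat n p" "B \<in> carrier_mat q p" "i < n" "j < q"
  shows "(A * transpose_mat B) $$ (i, j) = (\<Sum>k<p. A $$ (i, k) * B $$ (j, k))"
  using assms by (auto simp: scalar_prod_def atLeast0LessThan intro!: sum.cong)

lemma QUH_of_pair_carrier:
  assumes "A \<in> carrier_mat n p" "B \<in> carrier_mat n p"
  shows "QUH_of_pair m A B \<in> carrier_mat n p"
  using assms by (auto simp: QUH_of_pair_def)

text \<open>Writing the entry with \<open>Complex\<close> separates real and imaginary parts, so
  that equations between entries split into two real equations.\<close>

lemma QUH_of_pair_index:
  assumes "A \<in> carrier_mat n p" "B \<in> carrier_mat n p" "i < n" "j < p"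
  shows "QUH_of_pair m A B $$ (i, j) =
    Complex (A $$ (i, j) / sqrt (real m + 1)) (sqrt (real m / (real m + 1)) * B $$ (i, j))"
  using assms by (auto simp: QUH_of_pair_def complex_eq_iff)

text \<open>Each term of the inner product of rows i and j has the form (ca + idb)(ca' - idb') =
  c*c*aa' + d*d*bb' + i*cd*(ba' - ab'); summing over the columns turns the four real products into
  entries of the four matrix products.\<close>

lemma QUH_of_pair_gram_index:
  assumes A: "A \<in> carrier_mat n p" and B: "B \<in> carrier_mat n p" and ij: "i < n" "j < n"
  shows "(QUH_of_pair m A B * mat_adjoint (QUH_of_pair m A B)) $$ (i, j) =
    Complex
      (((A * transpose_mat A) $$ (i, j) + real m * (B * transpose_mat B) $$ (i, j)) / (real m + 1))
      (sqrt (real m) / (real m + 1) *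
        ((B * transpose_mat A) $$ (i, j) - (A * transpose_mat B) $$ (i, j)))"
proof -
  define c where "c = 1 / sqrt (real m + 1)"
  define d where "d = sqrt (real m / (real m + 1))"
  \<comment> \<open>Only these three products of \<open>c\<close> and \<open>d\<close> survive the
    expansion; in \<open>c * d\<close> the two roots of m + 1 multiply to m + 1.\<close>
  have coeffs: "c * c = 1 / (real m + 1)" "d * d = real m / (real m + 1)"
      "c * d = sqrt (real m) / (real m + 1)"
    by (simp_all add: c_def d_def real_sqrt_divide)
  have "(QUH_of_pair m A B * mat_adjoint (QUH_of_pair m A B)) $$ (i, j) =
      (\<Sum>k<p. Complex (c * A $$ (i, k)) (d * B $$ (i, k)) *
        cnj (Complex (c * A $$ (j, k)) (d * B $$ (j, k))))"
    using A B ij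
    by (simp add: mult_mat_adjoint_index[OF QUH_of_pair_carrier QUH_of_pair_carrier]
        QUH_of_pair_index c_def d_def)
  also have "\<dots> = (\<Sum>k<p. Complex
      (c * c * (A $$ (i, k) * A $$ (j, k)) + d * d * (B $$ (i, k) * B $$ (j, k)))
      (c * d * (B $$ (i, k) * A $$ (j, k) - A $$ (i, k) * B $$ (j, k))))"
    by (rule sum.cong) (auto simp: complex_eq_iff algebra_simps)
  also have "\<dots> = Complex
      (c * c * (A * transpose_mat A) $$ (i, j) + d * d * (B * transpose_mat B) $$ (i, j))
      (c * d * ((B * transpose_mat A) $$ (i, j) - (A * transpose_mat B) $$ (i, j)))"
    unfolding mult_transpose_mat_index[OF A A ij] mult_transpose_mat_index[OF B B ij]
      mult_transpose_mat_index[OF A B ij] mult_transpose_mat_index[OF B A ij]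
    by (simp add: complex_eq_iff sum.distrib sum_subtractf flip: sum_distrib_left)
  finally show ?thesis
    by (simp add: coeffs add_divide_distrib)
qed

text \<open>The target matrix is real, so all imaginary parts must vanish. Their common factor
  sqrt(m)/(m + 1) is nonzero because m > 0, which leaves amicability; clearing the denominator m + 1
  in the real parts gives the second equation.\<close>

lemma QUH_of_pair_gram_iff:
  assumes A: "A \<in> carrier_mat n p" and B: "B \<in> carrier_mat n p" and "m > 0"
  shows "QUH_of_pair m A B * mat_adjoint (QUH_of_pair m A B) = of_nat r \<cdot>\<^sub>m 1\<^sub>m n \<longleftrightarrow>
    amicable A B \<and>
    A * transpose_mat A + real m \<cdot>\<^sub>m (B * transpose_mat B) = ((real m + 1) * real r) \<cdot>\<^sub>m 1\<^sub>m n"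
    (is "?H * _ = _ \<longleftrightarrow> _ \<and> ?S = _")
proof -
  have pos: "real m + 1 > 0" by simp
  have entry: "(?H * mat_adjoint ?H) $$ (i, j) = (of_nat r \<cdot>\<^sub>m 1\<^sub>m n) $$ (i, j) \<longleftrightarrow>
      (A * transpose_mat B) $$ (i, j) = (B * transpose_mat A) $$ (i, j) \<and>
      ?S $$ (i, j) = (((real m + 1) * real r) \<cdot>\<^sub>m 1\<^sub>m n) $$ (i, j)"
    if "i < n" "j < n" for i j
  proof -
    have "?S $$ (i, j) = (A * transpose_mat A) $$ (i, j) + real m * (B * transpose_mat B) $$ (i, j)"
      \<comment> \<open>Entries of products stay folded, to match the form in
        \<open>QUH_of_pair_gram_index\<close>.\<close>
      using that A B by (simp del: index_mult_mat(1))
    then show ?thesis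
      unfolding QUH_of_pair_gram_index[OF A B that]
      using that \<open>m > 0\<close> pos by (auto simp: complex_eq_iff field_simps simp del: index_mult_mat)
  qed
  have dims: "?H * mat_adjoint ?H \<in> carrier_mat n n"
    using QUH_of_pair_carrier[OF A B, of m] by (auto simp: mat_adjoint_def)
  have "?H * mat_adjoint ?H = of_nat r \<cdot>\<^sub>m 1\<^sub>m n \<longleftrightarrow>
      (\<forall>i<n. \<forall>j<n. (?H * mat_adjoint ?H) $$ (i, j) = (of_nat r \<cdot>\<^sub>m 1\<^sub>m n) $$ (i, j))"
    using dims by (auto simp: mat_eq_iff simp del: index_mult_mat)
  moreover have "amicable A B \<longleftrightarrow>
      (\<forall>i<n. \<forall>j<n. (A * transpose_mat B) $$ (i, j) = (B * transpose_mat A) $$ (i, j))"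
    using A B by (auto simp: amicable_real mat_eq_iff simp del: index_mult_mat(1))
  moreover have "?S = ((real m + 1) * real r) \<cdot>\<^sub>m 1\<^sub>m n \<longleftrightarrow>
      (\<forall>i<n. \<forall>j<n. ?S $$ (i, j) = (((real m + 1) * real r) \<cdot>\<^sub>m 1\<^sub>m n) $$ (i, j))"
    using A B by (auto simp: mat_eq_iff simp del: index_mult_mat(1))
  ultimately show ?thesis
    using entry by blast
qed

text \<open>This brings the four values into the shape of \<open>QUH_of_pair_index\<close>, so that
  the entries of A and B can be matched directly with the signs \<epsilon> and \<delta>.\<close>

lemma QUH_entries_eq:
  "QUH_entries m = {Complex (\<epsilon> / sqrt (real m + 1)) (sqrt (real m / (real m + 1)) * \<delta>)
      | \<epsilon> \<delta>. \<epsilon> \<in> {1, -1} \<and> \<delta> \<in> {1, -1}}"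
proof -
  have "complex_of_real \<epsilon> * complex_of_real (1 / sqrt (real m + 1))
      + complex_of_real \<delta> * \<i> * complex_of_real (sqrt (real m / (real m + 1))) =
    Complex (\<epsilon> / sqrt (real m + 1)) (sqrt (real m / (real m + 1)) * \<delta>)" for \<epsilon> \<delta>
    by (simp add: complex_eq_iff)
  then show ?thesis
    by (simp only: QUH_entries_def)
qed

lemma cmod_QUH_entries:
  assumes "z \<in> QUH_entries m"
  shows "cmod z = 1"
proof -
  have "1 / (real m + 1) + real m / (real m + 1) = 1"
    by (simp add: field_simps)
  with assms show ?thesis
    by (auto simp: QUH_entries_eq cmod_def power_divide power_mult_distrib)
qed

lemma QUH_of_pair_entries:
  assumes A: "pm1_mat n A" and B: "pm1_mat n B" and ij: "i < n" "j < n"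
  shows "QUH_of_pair m A B $$ (i, j) \<in> QUH_entries m"
proof -
  have "A $$ (i, j) \<in> {1, -1}" "B $$ (i, j) \<in> {1, -1}"
    using A B ij by (auto simp: pm1_mat_def)
  moreover have "A \<in> carrier_mat n n" "B \<in> carrier_mat n n"
    using A B by (auto simp: pm1_mat_def)
  ultimately show ?thesis
    using QUH_of_pair_index[of A n n B i j m] ij by (auto simp only: QUH_entries_eq mem_Collect_eq)
qed

text \<open>For sign matrices the entries lie in \<open>QUH_entries m\<close> and hence have modulus
  1, so being a QUH reduces to the Gram equation.\<close>

lemma QUH_of_pair_iff:
  assumes A: "pm1_mat n A" and B: "pm1_mat n B" and "m > 0"
  shows "QUH n m (QUH_of_pair m A B) \<longleftrightarrow>
    amicable A B \<and>
    A * transpose_mat A + real m \<cdot>\<^sub>m (B * transpose_mat B) = ((real m + 1) * real n) \<cdot>\<^sub>m 1\<^sub>m n"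
proof -
  have carrier: "A \<in> carrier_mat n n" "B \<in> carrier_mat n n"
    using A B by (auto simp: pm1_mat_def)
  have "QUH n m (QUH_of_pair m A B) \<longleftrightarrow>
      QUH_of_pair m A B * mat_adjoint (QUH_of_pair m A B) = of_nat n \<cdot>\<^sub>m 1\<^sub>m n"
    using QUH_of_pair_entries[OF A B] QUH_of_pair_carrier[OF carrier]
    by (auto simp: QUH_def unit_hadamard_def intro: cmod_QUH_entries)
  then show ?thesis
    using QUH_of_pair_gram_iff[OF carrier \<open>m > 0\<close>] by simp
qed

text \<open>Each entry of H determines a choice of two signs; A collects those of the real parts and
  B those of the imaginary parts.\<close>

lemma ex_QUH_of_pair:
  assumes H: "H \<in> carrier_mat n n"
    and entries: "\<And>i j. i < n \<Longrightarrow> j < n \<Longrightarrow> H $$ (i, j) \<in> QUH_entries m"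
  shows "\<exists>A B. pm1_mat n A \<and> pm1_mat n B \<and> H = QUH_of_pair m A B"
proof -
  \<comment> \<open>The bounds on i and j stand inside the existential, so that choice yields total
    functions \<open>a\<close> and \<open>b\<close>.\<close>
  have "\<forall>i j. \<exists>\<epsilon> \<delta>. i < n \<longrightarrow> j < n \<longrightarrow> \<epsilon> \<in> {1, -1} \<and> \<delta> \<in> {1, -1} \<and>
      H $$ (i, j) = Complex (\<epsilon> / sqrt (real m + 1)) (sqrt (real m / (real m + 1)) * \<delta>)"
    using entries unfolding QUH_entries_eq by blast
  then obtain a b where ab: "\<And>i j. i < n \<Longrightarrow> j < n \<Longrightarrow> a i j \<in> {1, -1} \<and> b i j \<in> {1, -1} \<and>
      H $$ (i, j) = Complex (a i j / sqrt (real m + 1)) (sqrt (real m / (real m + 1)) * b i j)"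
    by metis
  define A B where "A = mat n n (\<lambda>(i, j). a i j)" and "B = mat n n (\<lambda>(i, j). b i j)"
  have carrier: "A \<in> carrier_mat n n" "B \<in> carrier_mat n n"
    by (simp_all add: A_def B_def)
  have "pm1_mat n A" "pm1_mat n B"
    using ab by (auto simp: pm1_mat_def A_def B_def)
  moreover have "H = QUH_of_pair m A B"
  proof (rule eq_matI)
    fix i j
    assume "i < dim_row (QUH_of_pair m A B)" "j < dim_col (QUH_of_pair m A B)"
    then have ij: "i < n" "j < n"
      using QUH_of_pair_carrier[OF carrier, of m] by auto
    then have "A $$ (i, j) = a i j" "B $$ (i, j) = b i j"
      by (simp_all add: A_def B_def)
    then show "H $$ (i, j) = QUH_of_pair m A B $$ (i, j)"
      using ab[OF ij] QUH_of_pair_index[OF carrier ij] by simp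
  qed (use H QUH_of_pair_carrier[OF carrier, of m] in auto)
  ultimately show ?thesis by blast
qed

theorem theorem2p6:
  fixes n m :: nat
  assumes "n > 0" and "m > 0"
  shows "(\<forall>A B. pm1_mat n A \<longrightarrow> pm1_mat n B \<longrightarrow>
            (QUH n m (QUH_of_pair m A B) \<longleftrightarrow>
               amicable A B \<and>
               A * transpose_mat A + real m \<cdot>\<^sub>m (B * transpose_mat B)
                 = ((real m + 1) * real n) \<cdot>\<^sub>m 1\<^sub>m n))
       \<and> (\<forall>H. QUH n m H \<longrightarrow>
            (\<exists>A B. pm1_mat n A \<and> pm1_mat n B \<and> H = QUH_of_pair m A B))"
  using QUH_of_pair_iff[OF _ _ \<open>m > 0\<close>] ex_QUH_of_pair
  by (auto simp: QUH_def unit_hadamard_def)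

end
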